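(* Let $\alpha\in\mathbb{C}$ with $\operatorname{Re}(\alpha)<0$ and let $n\ge N_{\operatorname{Re}(\alpha)}$ be an integer. Then $L_{\alpha,n}$ has the following eigenvectors. 1. $[1,\dots,1]^\top$ is an eigenvector associated to the eigenvalue $\lambda_{\alpha,n,2}=0$. 2. For every $j$ with $3\le j\le n$, the vector $v_{\alpha,n,j}=[v_{\alpha,n,j,k}]_{k=1}^n$ with components $$v_{\alpha,n,j,k}=\sin(kz_{\alpha,n,j})-(1-\overline{\alpha})\sin((k-1)z_{\alpha,n,j})+\overline{\alpha}\sin((n-k)z_{\alpha,n,j})$$ is an eigenvector associated to $\lambda_{\alpha,n,j}$. 3. The vector $v_{\alpha,n,1}=[v_{\alpha,n,1,k}]_{k=1}^n$ with components $$v_{\alpha,n,1,k}=\sinh(ks_{\alpha,n})-(1-\overline{\alpha})\sinh((k-1)s_{\alpha,n})+\overline{\alpha}\sinh((n-k)s_{\alpha,n})$$ is an eigenvector associated to $\lambda_{\alpha,n,1}$.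
   Context: For an integer $n\ge3$ and $\alpha\in\mathbb{C}$, $L_{\alpha,n}$ is the complex $n\times n$ matrix whose entries are: $(1,1)$ entry $1+\overline{\alpha}$; $(1,n)$ entry $-\overline{\alpha}$; $(n,1)$ entry $-\alpha$; $(n,n)$ entry $1+\alpha$; $(k,k)$ entries $2$ for $2\le k\le n-1$; $(k,k+1)$ and $(k+1,k)$ entries $-1$ for $1\le k\le n-1$; all other entries $0$. The characteristic polynomial of $L_{\alpha,n}$ equals that of the real symmetric matrix $L_{\operatorname{Re}(\alpha),n}$, so the eigenvalues of $L_{\alpha,n}$, counted with multiplicity, are real and are enumerated as $\lambda_{\alpha,n,1}\le\dots\le\lambda_{\alpha,n,n}$. For $a<0$ put $\varkappa_a=\frac{a-1}{a}$ and $N_a=\max\{3,\lfloor\varkappa_a\rfloor+1\}$. For $n\ge N_{\operatorname{Re}(\alpha)}$ one has $\lambda_{\alpha,n,1}<0$ and $\lambda_{\alpha,n,j}\in[0,4]$ for $j\ge2$; then $z_{\alpha,n,j}\in[0,\pi]$ is defined by $4\sin^2(z_{\alpha,n,j}/2)=\lambda_{\alpha,n,j}$ for $j\ge 2$, and $s_{\alpha,n}>0$ is defined by $-4\sinh^2(s_{\alpha,n}/2)=\lambda_{\alpha,n,1}$. *)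

theory Defs
  imports Complex_Main "Jordan_Normal_Form.Char_Poly"
begin

text \<open>
  Matrices and vectors of the library are indexed from 0. The entries and components are defined
  for the 1-based indices of the text, and the index is shifted when the matrix or vector is built.
\<close>

definition lap_entry :: "complex \<Rightarrow> nat \<Rightarrow> nat \<Rightarrow> nat \<Rightarrow> complex" where
  "lap_entry \<alpha> n i j =
     (if i = 1 \<and> j = 1 then 1 + cnj \<alpha>
      else if i = 1 \<and> j = n then - cnj \<alpha>
      else if i = n \<and> j = 1 then - \<alpha>
      else if i = n \<and> j = n then 1 + \<alpha>
      else if i = j then 2
      else if j = i + 1 \<or> i = j + 1 then -1
      else 0)"

definition lap :: "complex \<Rightarrow> nat \<Rightarrow> complex mat" where
  "lap \<alpha> n = mat n n (\<lambda>(i, j). lap_entry \<alpha> n (i + 1) (j + 1))"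

text \<open>
  The eigenvalues counted with algebraic multiplicity, in nondecreasing order. That they are real
  is not built in: the list exists only because the characteristic polynomial splits over the reals
  (its length is then the degree \<open>n\<close>), and it is unique because it is sorted.
\<close>

definition lap_eigenvalues :: "complex \<Rightarrow> nat \<Rightarrow> real list" where
  "lap_eigenvalues \<alpha> n =
     (THE xs. sorted xs \<and> char_poly (lap \<alpha> n) = (\<Prod>x\<leftarrow>xs. [:- complex_of_real x, 1:]))"

definition lap_lambda :: "complex \<Rightarrow> nat \<Rightarrow> nat \<Rightarrow> real" where
  "lap_lambda \<alpha> n j = lap_eigenvalues \<alpha> n ! (j - 1)"

definition kappa :: "real \<Rightarrow> real" where
  "kappa a = (a - 1) / a"

definition N_min :: "real \<Rightarrow> int" where
  "N_min a = max 3 (\<lfloor>kappa a\<rfloor> + 1)"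

text \<open>
  The next two are meaningful for \<open>Re \<alpha> < 0\<close> and \<open>n \<ge> N_min (Re \<alpha>)\<close> (and \<open>2 \<le> j \<le> n\<close> for the first),
  when \<open>lap_lambda \<alpha> n j\<close> lies in \<open>[0, 4]\<close> and \<open>lap_lambda \<alpha> n 1\<close> is negative, respectively.
\<close>

definition lap_z :: "complex \<Rightarrow> nat \<Rightarrow> nat \<Rightarrow> real" where
  "lap_z \<alpha> n j = (THE z. 0 \<le> z \<and> z \<le> pi \<and> 4 * (sin (z / 2))\<^sup>2 = lap_lambda \<alpha> n j)"

definition lap_s :: "complex \<Rightarrow> nat \<Rightarrow> real" where
  "lap_s \<alpha> n = (THE s. 0 < s \<and> - 4 * (sinh (s / 2))\<^sup>2 = lap_lambda \<alpha> n 1)"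

definition v_trig :: "complex \<Rightarrow> nat \<Rightarrow> nat \<Rightarrow> nat \<Rightarrow> complex" where
  "v_trig \<alpha> n j k =
     complex_of_real (sin (real k * lap_z \<alpha> n j))
     - (1 - cnj \<alpha>) * complex_of_real (sin ((real k - 1) * lap_z \<alpha> n j))
     + cnj \<alpha> * complex_of_real (sin ((real n - real k) * lap_z \<alpha> n j))"

definition v_hyp :: "complex \<Rightarrow> nat \<Rightarrow> nat \<Rightarrow> complex" where
  "v_hyp \<alpha> n k =
     complex_of_real (sinh (real k * lap_s \<alpha> n))
     - (1 - cnj \<alpha>) * complex_of_real (sinh ((real k - 1) * lap_s \<alpha> n))
     + cnj \<alpha> * complex_of_real (sinh ((real n - real k) * lap_s \<alpha> n))"

definition lap_vec :: "nat \<Rightarrow> (nat \<Rightarrow> complex) \<Rightarrow> complex vec" where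
  "lap_vec n v = vec n (\<lambda>i. v (i + 1))"

end

theory Submission
  imports Defs "HOL-Analysis.Complex_Transcendental"
begin

text \<open>
  Write \<open>\<lambda> = 2 - 2 cos w\<close> with complex \<open>w\<close>. The rows \<open>2, \<dots>, n - 1\<close> of \<open>(L - \<lambda>) v = 0\<close> say that \<open>v\<close> satisfies
  the recurrence of \<open>k \<mapsto> sin (k w + c)\<close>. The sequence \<open>sine_vec\<close> is the combination of such sines that
  satisfies the first row for every \<open>w\<close>, so only the last row is a condition on \<open>w\<close>
  (\<open>sine_vec_last_row\<close>). It involves only \<open>a = Re \<alpha>\<close>, and it factors as
  \<open>sin (w/2) sin (n w/2) F w = 0\<close> with \<open>F w = sin ((n+1) w/2) - (1 - 2 a) sin ((n-1) w/2)\<close>. The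
  factors reflect a symmetry: for real \<open>\<alpha>\<close> the matrix commutes with the reversal of the coordinates,
  zeros of \<open>sin (n w/2)\<close> give symmetric eigenvectors, and zeros of \<open>F\<close> antisymmetric ones. Real \<open>w\<close>
  gives the trigonometric vectors and \<open>w = \<i> s\<close> the hyperbolic one, up to the factor \<open>- \<i>\<close>, so one
  computation (\<open>eigenvector_if_char_root\<close>) serves both. It includes that the vector is not zero.

  What remains is to know that these roots exhaust the spectrum, in the right order. Here \<open>n\<close>
  distinct eigenvalues are exhibited:
  \<^item> one negative eigenvalue, from a zero of \<open>F\<close> on the imaginary axis; the hypothesis \<open>n > (a - 1)/a\<close>
    says exactly that \<open>s \<mapsto> F (\<i> s)/\<i>\<close> is decreasing at \<open>0\<close>, while it is positive for large \<open>s\<close>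
    (\<open>ex_hyperbolic_root\<close>);
  \<^item> the eigenvalue \<open>0\<close> of the constant vector;
  \<^item> the zeros \<open>2 \<pi> m/n\<close> of \<open>sin (n w/2)\<close> in \<open>(0, \<pi>)\<close>, and between any two neighbouring ones in \<open>(0, \<pi>]\<close>
    a zero of \<open>F\<close>, which changes sign there; these are \<open>n - 2\<close> in total (\<open>ex_trig_roots\<close>).

  A monic polynomial of degree \<open>n\<close> is determined by \<open>n\<close> distinct roots, hence the sorted list of these
  numbers is the list of eigenvalues with multiplicity (\<open>lap_eigenvalues_eqI\<close>). It starts with the
  negative one, then \<open>0\<close>, and all others come from some \<open>w\<close> in \<open>(0, \<pi>)\<close>. As \<open>w \<mapsto> 2 - 2 cos w\<close> is
  injective on \<open>[0, \<pi>]\<close>, and \<open>sinh\<close> is injective, the parameters in the claimed formulas are the roots found here.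
\<close>

(* From here on, $ selects a component of a vector of variable dimension. *)
unbundle no vec_syntax

section \<open>Eigenvectors from roots of the characteristic equation\<close>

text \<open>
  The components \<open>v\<^sub>k\<close> for a complex angle \<open>w\<close>. The index \<open>x\<close> is complex too, so that the sequence
  extends to \<open>k = 0\<close> and \<open>k = n + 1\<close>, where the boundary rows of the matrix become boundary conditions.
\<close>

definition sine_vec :: "complex \<Rightarrow> nat \<Rightarrow> complex \<Rightarrow> complex \<Rightarrow> complex" where
  "sine_vec \<alpha> n w x =
     sin (x * w) - (1 - cnj \<alpha>) * sin ((x - 1) * w) + cnj \<alpha> * sin ((of_nat n - x) * w)"

lemma sine_vec_recurrence:
  "sine_vec \<alpha> n w (x + 1) + sine_vec \<alpha> n w (x - 1) = 2 * cos w * sine_vec \<alpha> n w x"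
proof -
  have step: "sin (y + w) + sin (y - w) = 2 * cos w * sin y" for y
    by (simp add: sin_add sin_diff)
  have h1: "sin ((x + 1) * w) + sin ((x - 1) * w) = 2 * cos w * sin (x * w)"
    using step[of "x * w"] by (simp add: algebra_simps)
  have h2: "sin ((x + 1 - 1) * w) + sin ((x - 1 - 1) * w) = 2 * cos w * sin ((x - 1) * w)"
    using step[of "(x - 1) * w"] by (simp add: algebra_simps)
  have h3: "sin ((of_nat n - (x + 1)) * w) + sin ((of_nat n - (x - 1)) * w)
      = 2 * cos w * sin ((of_nat n - x) * w)"
    using step[of "(of_nat n - x) * w"] by (simp add: algebra_simps)
  have "sine_vec \<alpha> n w (x + 1) + sine_vec \<alpha> n w (x - 1) =
      (sin ((x + 1) * w) + sin ((x - 1) * w))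
      - (1 - cnj \<alpha>) * (sin ((x + 1 - 1) * w) + sin ((x - 1 - 1) * w))
      + cnj \<alpha> * (sin ((of_nat n - (x + 1)) * w) + sin ((of_nat n - (x - 1)) * w))"
    unfolding sine_vec_def by (simp only: distrib_left) simp
  also have "\<dots> = 2 * cos w * sine_vec \<alpha> n w x"
    unfolding h1 h2 h3 sine_vec_def by (simp only: distrib_left right_diff_distrib mult_ac)
  finally show ?thesis .
qed

text \<open>
  Given the recurrence, this is equivalent to the first row of the eigenvalue equation. It is an
  identity in \<open>w\<close>; this is what singles out \<open>sine_vec\<close> among the solutions of the recurrence.
\<close>

lemma sine_vec_first_row:
  "sine_vec \<alpha> n w 0 = (1 - cnj \<alpha>) * sine_vec \<alpha> n w 1 + cnj \<alpha> * sine_vec \<alpha> n w (of_nat n)"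
  by (simp add: sine_vec_def algebra_simps)

text \<open>
  The zeros with \<open>sin w \<noteq> 0\<close> are the angles of the antisymmetric eigenvectors
  \<open>k \<mapsto> sin ((n + 1 - 2 k) w/2)\<close> of the matrix with real parameter \<open>a\<close>: it expresses the first row
  \<open>v\<^sub>0 = (1 - a) v\<^sub>1 + a v\<^sub>n\<close> with \<open>v\<^sub>n = - v\<^sub>1\<close>.
\<close>

definition antisym_factor :: "real \<Rightarrow> nat \<Rightarrow> 'a::{real_normed_field,banach} \<Rightarrow> 'a" where
  "antisym_factor a n w = sin ((of_nat n + 1) * w / 2) - of_real (1 - 2 * a) * sin ((of_nat n - 1) * w / 2)"

text \<open>
  The left-hand side vanishes iff the last row of the eigenvalue equation holds, so the right-hand
  side is the characteristic polynomial in trigonometric form, up to the constant and a factor \<open>sin w\<close>.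
  In the half angles \<open>A = n w/2\<close> and \<open>x = w/2\<close> it is a polynomial identity.
\<close>

lemma sine_vec_last_row:
  "sine_vec \<alpha> n w (of_nat n + 1) - \<alpha> * sine_vec \<alpha> n w 1 - (1 - \<alpha>) * sine_vec \<alpha> n w (of_nat n)
     = - 4 * sin (w / 2) * sin (of_nat n * w / 2) * antisym_factor (Re \<alpha>) n w"
proof -
  define A where "A = of_nat n * w / 2"
  define x where "x = w / 2"
  have args: "(of_nat n + 1) * w = 2 * A + 2 * x" "of_nat n * w = 2 * A"
    "(of_nat n - 1) * w = 2 * A - 2 * x" "w = 2 * x"
    "(of_nat n - (of_nat n + 1)) * w = - (2 * x)"
    "(of_nat n + 1) * w / 2 = A + x" "(of_nat n - 1) * w / 2 = A - x" "of_nat n * w / 2 = A"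
    by (simp_all add: A_def x_def field_simps)
  have re: "complex_of_real (1 - 2 * Re \<alpha>) = 1 - \<alpha> - cnj \<alpha>"
    by (simp add: complex_eq_iff)
  have d: "sin (2 * A) = 2 * sin A * cos A" "sin (2 * x) = 2 * sin x * cos x"
    "cos (2 * A) = 1 - 2 * sin A ^ 2" "cos (2 * x) = 1 - 2 * sin x ^ 2"
    by (simp_all add: sin_double cos_double_sin)
  have w2: "sin w = 2 * sin x * cos x" using args(4) d(2) by simp
  show ?thesis
    unfolding sine_vec_def antisym_factor_def re args(6,7)
    by (simp add: args(1,2,3,5) args(8) x_def[symmetric] sin_add sin_diff d w2)
      (simp add: power2_eq_square algebra_simps)
qed

text \<open>
  If both components vanished, eliminating \<open>\<alpha>\<close> would give \<open>sin (n w) = sin w + sin ((n - 1) w)\<close>, which factors as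
  \<open>sin (n w/2) sin ((n - 1) w/2) sin (w/2) = 0\<close>. If \<open>sin (n w/2) = 0\<close> then \<open>\<alpha> = 1\<close>, and otherwise \<open>sin w = 0\<close>.
\<close>

lemma sine_vec_start_nonzero:
  assumes "\<alpha> \<noteq> 0" "\<alpha> \<noteq> 1" "sin w \<noteq> 0"
  shows "sine_vec \<alpha> n w 0 \<noteq> 0 \<or> sine_vec \<alpha> n w 1 \<noteq> 0"
proof (rule ccontr)
  assume "\<not> ?thesis"
  (* The two vanishing components as equations for sin w. *)
  then have v0: "sin w = cnj \<alpha> * (sin w - sin (of_nat n * w))"
    and v1: "sin w = - cnj \<alpha> * sin ((of_nat n - 1) * w)"
    by (simp_all add: sine_vec_def algebra_simps eq_neg_iff_add_eq_0)
  define A where "A = of_nat n * w / 2"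
  define x where "x = w / 2"
  have args: "of_nat n * w = 2 * A" "(of_nat n - 1) * w = 2 * A - 2 * x" "w = 2 * x"
    by (simp_all add: A_def x_def field_simps)
  have ca: "cnj \<alpha> \<noteq> 0" "cnj \<alpha> \<noteq> 1"
    using assms by simp_all
  have sx: "sin x \<noteq> 0"
    using assms(3) args(3) by (auto simp: sin_double)
  have solve: "q = p + r" if "p = u * (p - q)" "p = - u * r" "u \<noteq> 0" for p q r u :: complex
  proof -
    have "u * q = u * p - p" using that(1) by (simp add: algebra_simps)
    moreover have "u * r = - p" using that(2) by simp
    ultimately have "u * q = u * (p + r)" by (simp add: distrib_left)
    then show ?thesis using that(3) by simp
  qed
  have "sin (2 * A) = sin (2 * x) + sin (2 * A - 2 * x)"
    using solve[OF v0 v1 ca(1)] unfolding args(1,2) unfolding args(3) .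
  moreover have "sin (2 * A) - sin (2 * A - 2 * x) = 2 * sin x * cos (2 * A - x)"
  proof -
    have mean: "(2 * A - (2 * A - 2 * x)) / 2 = x" "(2 * A + (2 * A - 2 * x)) / 2 = 2 * A - x"
      by simp_all
    show ?thesis using sin_diff_sin[of "2 * A" "2 * A - 2 * x"] unfolding mean .
  qed
  ultimately have "cos (2 * A - x) = cos x"
    using sx by (simp add: sin_double)
  then have "sin A * sin (A - x) = 0"
  proof -
    have mean: "(2 * A - x + x) / 2 = A" "(x - (2 * A - x)) / 2 = - (A - x)"
      by (simp_all add: field_simps)
    show ?thesis
      using cos_diff_cos[of "2 * A - x" x] \<open>cos (2 * A - x) = cos x\<close> unfolding mean sin_minus by simp
  qed
  then consider "sin A = 0" | "sin (A - x) = 0" by auto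
  then show False
  proof cases
    case 1
    have "cos (2 * A) = 1" "sin (2 * A) = 0"
      using 1 by (simp_all add: cos_double_sin sin_double)
    then have "sin w = cnj \<alpha> * sin w"
      using v1 unfolding args(2) by (simp add: sin_diff args(3)[symmetric])
    then show False using assms(3) ca by simp
  next
    case 2
    have "sin (2 * A - 2 * x) = 0"
      using 2 sin_double[of "A - x"] by (simp add: algebra_simps)
    then show False using v1 assms(3) unfolding args(2) by simp
  qed
qed

text \<open>
  The index \<open>i\<close> of the matrix counts from 0, the argument of \<open>v\<close> from 1. Every row has three possibly nonzero entries, as \<open>n \<ge> 3\<close> keeps the corners apart
  from the off-diagonals.
\<close>

lemma lap_mult_vec:
  assumes n: "n \<ge> 3" and i: "i < n"
  shows "(lap \<alpha> n *\<^sub>v lap_vec n v) $ i =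
    (if i = 0 then (1 + cnj \<alpha>) * v 1 - v 2 - cnj \<alpha> * v n
     else if i = n - 1 then (1 + \<alpha>) * v n - v (n - 1) - \<alpha> * v 1
     else 2 * v (i + 1) - v i - v (i + 2))"
proof -
  have row: "(lap \<alpha> n *\<^sub>v lap_vec n v) $ i = (\<Sum>j<n. lap_entry \<alpha> n (i + 1) (j + 1) * v (j + 1))"
    using i by (simp add: lap_def lap_vec_def scalar_prod_def atLeast0LessThan)
  have three: "(\<Sum>j<n. lap_entry \<alpha> n (i + 1) (j + 1) * v (j + 1)) =
      lap_entry \<alpha> n (i + 1) (p + 1) * v (p + 1) + (lap_entry \<alpha> n (i + 1) (q + 1) * v (q + 1)
      + lap_entry \<alpha> n (i + 1) (r + 1) * v (r + 1))"
    if "p < n" "q < n" "r < n" "p \<noteq> q" "p \<noteq> r" "q \<noteq> r"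
      and zero: "\<And>j. j < n \<Longrightarrow> j \<noteq> p \<Longrightarrow> j \<noteq> q \<Longrightarrow> j \<noteq> r \<Longrightarrow> lap_entry \<alpha> n (i + 1) (j + 1) = 0"
    for p q r
  proof -
    have "(\<Sum>j<n. lap_entry \<alpha> n (i + 1) (j + 1) * v (j + 1)) =
        (\<Sum>j\<in>{p, q, r}. lap_entry \<alpha> n (i + 1) (j + 1) * v (j + 1))"
      using that(1-3) zero by (intro sum.mono_neutral_right) auto
    then show ?thesis using that(4-6) by simp
  qed
  consider "i = 0" | "i = n - 1" "i \<noteq> 0" | "0 < i" "i < n - 1" using i by linarith
  then show ?thesis
  proof cases
    case 1
    show ?thesis
      unfolding row using 1 n
      by (subst three[of 0 1 "n - 1"]) (auto simp: lap_entry_def numeral_2_eq_2)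
  next
    case 2
    have shift: "n - 2 + 1 = n - 1" "n - 1 + 1 = n" using n by simp_all
    show ?thesis
      unfolding row using 2 n
      by (subst three[of "n - 1" "n - 2" 0]; (unfold shift)?) (auto simp: lap_entry_def)
  next
    case 3
    have shift: "i - 1 + 1 = i" using 3 by simp
    show ?thesis
      unfolding row using 3 n
      by (subst three[of i "i - 1" "i + 1"]; (unfold shift)?) (auto simp: lap_entry_def)
  qed
qed

lemma eigenvector_ones:
  assumes "n \<ge> 3"
  shows "eigenvector (lap \<alpha> n) (lap_vec n (\<lambda>k. 1)) 0"
proof -
  have "lap \<alpha> n *\<^sub>v lap_vec n (\<lambda>k. 1) = 0 \<cdot>\<^sub>v lap_vec n (\<lambda>k. 1)"
  proof (rule eq_vecI)
    fix i assume "i < dim_vec (0 \<cdot>\<^sub>v lap_vec n (\<lambda>k. 1))"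
    then have "i < n" by (simp add: lap_vec_def)
    then show "(lap \<alpha> n *\<^sub>v lap_vec n (\<lambda>k. 1)) $ i = (0 \<cdot>\<^sub>v lap_vec n (\<lambda>k. 1)) $ i"
      using lap_mult_vec[OF assms, of i \<alpha> "\<lambda>k. 1"] by (simp add: lap_vec_def)
  qed (simp add: lap_def lap_vec_def)
  moreover have "lap_vec n (\<lambda>k. 1) $ 0 \<noteq> 0\<^sub>v n $ 0"
    using assms by (simp add: lap_vec_def)
  ultimately show ?thesis
    unfolding eigenvector_def by (auto simp: lap_def lap_vec_def)
qed

text \<open>
  The scalar \<open>c\<close> is there for \<open>w = \<i> s\<close>, where \<open>sine_vec\<close> is \<open>\<i>\<close> times a combination of hyperbolic sines.
  The hypothesis on \<open>sin w\<close> excludes the roots at which all components vanish.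
\<close>

lemma eigenvector_if_char_root:
  assumes n: "n \<ge> 3" and \<alpha>: "\<alpha> \<noteq> 0" "\<alpha> \<noteq> 1" and w: "sin w \<noteq> 0"
    and root: "sin (of_nat n * w / 2) * antisym_factor (Re \<alpha>) n w = 0"
    and c: "c \<noteq> 0"
  shows "eigenvector (lap \<alpha> n) (lap_vec n (\<lambda>k. c * sine_vec \<alpha> n w (of_nat k))) (2 - 2 * cos w)"
proof -
  define g where "g = sine_vec \<alpha> n w"
  define v where "v k = c * g (of_nat k)" for k
  have rec: "g (x - 1) = 2 * cos w * g x - g (x + 1)" for x
    using sine_vec_recurrence[of \<alpha> n w x] unfolding g_def by (simp add: algebra_simps)
  have nat_rec: "v k = 2 * cos w * v (k + 1) - v (k + 2)" for k
  proof -
    have "g (of_nat k) = 2 * cos w * g (of_nat (k + 1)) - g (of_nat (k + 2))"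
      using rec[of "of_nat k + 1"] by (simp add: algebra_simps)
    then show ?thesis unfolding v_def by (simp only: right_diff_distrib mult_ac)
  qed
  have first: "v 0 = (1 - cnj \<alpha>) * v 1 + cnj \<alpha> * v n"
    by (simp add: v_def g_def sine_vec_first_row[of \<alpha> n w] algebra_simps)
  have "g (of_nat n + 1) - \<alpha> * g 1 - (1 - \<alpha>) * g (of_nat n) = 0"
    using sine_vec_last_row[of \<alpha> n w] root unfolding g_def by auto
  then have "g (of_nat n + 1) = \<alpha> * g 1 + (1 - \<alpha>) * g (of_nat n)"
    by (simp add: diff_diff_eq)
  then have "v (n + 1) = c * (\<alpha> * g 1 + (1 - \<alpha>) * g (of_nat n))"
    by (simp only: v_def of_nat_add of_nat_1)
  then have last: "v (n + 1) = \<alpha> * v 1 + (1 - \<alpha>) * v n"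
    by (simp add: v_def algebra_simps)
  (* Each row is the recurrence; in the first and last row it is combined with the boundary condition. *)
  have "lap \<alpha> n *\<^sub>v lap_vec n v = (2 - 2 * cos w) \<cdot>\<^sub>v lap_vec n v"
  proof (rule eq_vecI)
    fix i assume "i < dim_vec ((2 - 2 * cos w) \<cdot>\<^sub>v lap_vec n v)"
    then have i: "i < n" by (simp add: lap_vec_def)
    have "(lap \<alpha> n *\<^sub>v lap_vec n v) $ i = (2 - 2 * cos w) * v (i + 1)"
    proof (cases "i = 0")
      case True
      have "v 0 = 2 * cos w * v 1 - v 2" using nat_rec[of 0] by (simp add: numeral_2_eq_2)
      then show ?thesis
        using True first unfolding lap_mult_vec[OF n i] by (simp add: algebra_simps)
    next
      case False
      show ?thesis
      proof (cases "i = n - 1")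
        case True
        have "v (n - 1) = 2 * cos w * v n - v (n + 1)" using nat_rec[of "n - 1"] n by simp
        then have "v (n - 1) = 2 * cos w * v n - (\<alpha> * v 1 + (1 - \<alpha>) * v n)"
          unfolding last .
        then show ?thesis
          using True False n unfolding lap_mult_vec[OF n i] by (simp add: algebra_simps)
      next
        case False
        then show ?thesis
          using \<open>i \<noteq> 0\<close> nat_rec[of i] unfolding lap_mult_vec[OF n i] by (simp add: algebra_simps)
      qed
    qed
    then show "(lap \<alpha> n *\<^sub>v lap_vec n v) $ i = ((2 - 2 * cos w) \<cdot>\<^sub>v lap_vec n v) $ i"
      using i by (simp add: lap_vec_def)
  qed (simp add: lap_def lap_vec_def)
  moreover have "lap_vec n v \<noteq> 0\<^sub>v n"
  proof
    (* Components 0 and 1 determine the sequence, but the vector starts at component 1; the recurrence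
       run backwards turns v 1 = v 2 = 0 into v 0 = v 1 = 0. *)
    assume zero: "lap_vec n v = 0\<^sub>v n"
    have "lap_vec n v $ 0 = 0" "lap_vec n v $ 1 = 0"
      unfolding zero using n by simp_all
    then have "v 1 = 0" "v 2 = 0"
      using n by (simp_all add: lap_vec_def numeral_2_eq_2)
    moreover from this have "v 0 = 0" using nat_rec[of 0] by (simp add: numeral_2_eq_2)
    ultimately show False
      using sine_vec_start_nonzero[OF \<alpha> w, of n] c by (simp add: v_def g_def)
  qed
  ultimately show ?thesis
    unfolding eigenvector_def v_def g_def by (auto simp: lap_def lap_vec_def)
qed

section \<open>Locating the roots\<close>

text \<open>
  The difference of the two sides vanishes at \<open>s = 0\<close>, where its slope is \<open>1 + a (n - 1)\<close>, negative iff
  \<open>n > (a - 1)/a\<close>. For \<open>e\<^sup>s \<ge> 1 - 2 a\<close> it is nonnegative, because \<open>sinh (y + s) \<ge> e\<^sup>s sinh y\<close> for \<open>y \<ge> 0\<close>.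
\<close>

lemma ex_hyperbolic_root:
  assumes a: "a < 0" and n: "real n > kappa a" "n \<ge> 3"
  shows "\<exists>s>0. sinh ((real n + 1) * s / 2) = (1 - 2 * a) * sinh ((real n - 1) * s / 2)"
proof -
  define G where "G s = sinh ((real n + 1) * s / 2) - (1 - 2 * a) * sinh ((real n - 1) * s / 2)" for s
  have slope: "(real n + 1) / 2 - (1 - 2 * a) * ((real n - 1) / 2) < 0"
    using n a by (simp add: kappa_def field_simps)
  have "(G has_real_derivative (real n + 1) / 2 - (1 - 2 * a) * ((real n - 1) / 2)) (at 0)"
    unfolding G_def by (auto intro!: derivative_eq_intros simp: field_simps)
  from DERIV_neg_dec_right[OF this slope] obtain d where
    d: "d > 0" "\<And>h. 0 < h \<Longrightarrow> h < d \<Longrightarrow> G h < G 0" by auto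
  (* Any t with exp t \<ge> 1 - 2 * a would do; adding d puts it to the right of d / 2. *)
  define t where "t = ln (2 - 2 * a) + d"
  have ln0: "ln (2 - 2 * a) > 0" using a by simp
  have "G (d / 2) < 0" using d(2)[of "d/2"] d(1) by (simp add: G_def)
  moreover have "G t \<ge> 0"
  proof -
    define y where "y = (real n - 1) * t / 2"
    have t: "t > 0" "exp t \<ge> 1 - 2 * a"
    proof -
      show "t > 0" using ln0 d by (simp add: t_def)
      have "exp t \<ge> exp (ln (2 - 2 * a))" unfolding t_def using d by simp
      then show "exp t \<ge> 1 - 2 * a" using a by simp
    qed
    have y: "y > 0" using t n by (simp add: y_def)
    have "sinh (y + t) \<ge> exp t * sinh y"
    proof -
      have "sinh (y + t) - exp t * sinh y = sinh t * (cosh y - sinh y)"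
        by (simp add: sinh_add sinh_plus_cosh[symmetric] algebra_simps)
      moreover have "\<dots> \<ge> 0" using t sinh_le_cosh_real[of y] by simp
      ultimately show ?thesis by linarith
    qed
    moreover have "exp t * sinh y \<ge> (1 - 2 * a) * sinh y"
      using t y by (intro mult_right_mono) auto
    moreover have "G t = sinh (y + t) - (1 - 2 * a) * sinh y"
    proof -
      have "(real n + 1) * t / 2 = y + t" by (simp add: y_def field_simps)
      then show ?thesis by (simp only: G_def y_def[symmetric])
    qed
    ultimately show ?thesis by linarith
  qed
  ultimately have "\<exists>s. d / 2 \<le> s \<and> s \<le> t \<and> G s = 0"
    using d ln0 by (intro IVT') (auto simp: G_def t_def intro!: continuous_intros)
  then obtain s where "d / 2 \<le> s" "G s = 0" by blast
  then show ?thesis using d by (intro exI[of _ s]) (auto simp: G_def)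
qed

text \<open>The alternating sign separates the antisymmetric angles from the symmetric ones \<open>2 \<pi> m/n\<close>.\<close>

lemma antisym_factor_at_grid_point:
  assumes "n > 0"
  shows "antisym_factor a n (2 * pi * real m / real n) = (-1) ^ m * (2 - 2 * a) * sin (pi * real m / real n)"
proof -
  have args: "(real n + 1) * (2 * pi * real m / real n) / 2 = pi * real m + pi * real m / real n"
    "(real n - 1) * (2 * pi * real m / real n) / 2 = pi * real m - pi * real m / real n"
    using assms by (simp_all add: field_simps)
  show ?thesis
    unfolding antisym_factor_def args sin_add sin_diff
    by (simp add: left_diff_distrib right_diff_distrib)
qed

lemma ex_antisym_root_between:
  assumes a: "a < 0" and m: "1 \<le> m" "2 * (m + 1) \<le> n"
  shows "\<exists>z. 2 * pi * real m / real n < z \<and> z < 2 * pi * real (m + 1) / real n \<and> antisym_factor a n z = 0"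
proof -
  define F where "F z = (-1) ^ m * antisym_factor a n z" for z :: real
  define l where "l = 2 * pi * real m / real n"
  define r where "r = 2 * pi * real (m + 1) / real n"
  have n: "n > 0" using m by simp
  have pos: "sin (pi * real k / real n) > 0" if "1 \<le> k" "2 * k \<le> n" for k
  proof (rule sin_gt_zero)
    show "0 < pi * real k / real n" using that n by simp
    have "real k < real n" using that by simp
    then show "pi * real k / real n < pi" using n by (simp add: field_simps)
  qed
  have sign: "(-1) ^ m * ((-1) ^ m * y) = y" for y :: real
    by (simp flip: mult.assoc power_mult_distrib)
  have "F l > 0"
    using pos[of m] m a n unfolding F_def l_def antisym_factor_at_grid_point[OF n]
    by (simp add: mult.assoc sign)
  moreover have "F r < 0"
    using pos[of "m + 1"] m a n unfolding F_def r_def antisym_factor_at_grid_point[OF n]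
    by (simp add: mult.assoc sign)
  moreover have "l \<le> r" using n by (simp add: l_def r_def field_simps)
  ultimately have "\<exists>z. l \<le> z \<and> z \<le> r \<and> F z = 0"
    by (intro IVT2') (auto simp: F_def antisym_factor_def intro!: continuous_intros)
  then obtain z where z: "l \<le> z" "z \<le> r" "F z = 0" by blast
  then have "z \<noteq> l" "z \<noteq> r" using \<open>F l > 0\<close> \<open>F r < 0\<close> by auto
  with z show ?thesis unfolding F_def l_def r_def by (intro exI[of _ z]) auto
qed

text \<open>
  The roots are labelled by position: \<open>h k = \<pi> k/n\<close> for even \<open>k\<close>, and for odd \<open>k\<close> a root strictly
  between the neighbouring points \<open>\<pi> (k - 1)/n\<close> and \<open>\<pi> (k + 1)/n\<close>. Thus \<open>h\<close> is strictly increasing, whatever the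
  parity of \<open>n\<close>. The label \<open>k = 1\<close> is missing, since the sign change needs \<open>m \<ge> 1\<close>; for
  \<open>n > (a - 1)/a\<close> that root lies on the imaginary axis. The label \<open>k = 0\<close> belongs to the eigenvalue \<open>0\<close>.
\<close>

lemma ex_trig_roots:
  assumes a: "a < 0"
  shows "\<exists>h. inj_on h {2..<n} \<and> (\<forall>k\<in>{2..<n}. 0 < h k \<and> h k < pi
           \<and> sin (real n * h k / 2) * antisym_factor a n (h k) = 0)"
proof -
  have "\<exists>z. 0 < z \<and> z < pi \<and> sin (real n * z / 2) * antisym_factor a n z = 0
      \<and> (if even k then z = pi * real k / real n
         else pi * (real k - 1) / real n < z \<and> z < pi * (real k + 1) / real n)"
    if k: "k \<in> {2..<n}" for k
  proof (cases "even k")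
    case True
    then obtain m where m: "k = 2 * m" by auto
    have "sin (real n * (pi * real k / real n) / 2) = 0" using k by (simp add: m)
    moreover have "0 < pi * real k / real n" "pi * real k / real n < pi"
      using k by (simp_all add: field_simps)
    ultimately show ?thesis using True by auto
  next
    case False
    then obtain m where m: "k = 2 * m + 1" by (auto elim: oddE)
    obtain z where z: "2 * pi * real m / real n < z" "z < 2 * pi * real (m + 1) / real n"
      "antisym_factor a n z = 0"
      using ex_antisym_root_between[OF a, of m n] k m by auto
    have "0 \<le> 2 * pi * real m / real n" by simp
    moreover have "2 * pi * real (m + 1) / real n \<le> pi"
    proof -
      have "2 * real (m + 1) \<le> real n" using k m by simp
      then have "pi * (2 * real (m + 1)) \<le> pi * real n" by (intro mult_left_mono) auto
      then show ?thesis using k by (simp add: field_simps)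
    qed
    ultimately have "0 < z" "z < pi" using z by linarith+
    moreover have "pi * (real k - 1) / real n < z" "z < pi * (real k + 1) / real n"
      using z(1,2) by (simp_all add: m algebra_simps)
    ultimately show ?thesis using False z(3) by auto
  qed
  then obtain h where h: "\<And>k. k \<in> {2..<n} \<Longrightarrow> 0 < h k \<and> h k < pi
      \<and> sin (real n * h k / 2) * antisym_factor a n (h k) = 0
      \<and> (if even k then h k = pi * real k / real n
         else pi * (real k - 1) / real n < h k \<and> h k < pi * (real k + 1) / real n)"
    by metis
  have "h k < h l" if kl: "k \<in> {2..<n}" "l \<in> {2..<n}" "k < l" for k l
  proof -
    have mono: "pi * x / real n \<le> pi * y / real n" if "x \<le> y" for x y
      using that by (simp add: divide_right_mono)
    have smono: "pi * x / real n < pi * y / real n" if "x < y" for x y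
      using that kl by (simp add: divide_strict_right_mono)
    consider "even k" "even l" | "even k" "odd l" | "odd k" "even l" | "odd k" "odd l" by blast
    then show ?thesis
    proof cases
      case 1
      then show ?thesis using h[OF kl(1)] h[OF kl(2)] smono[of k l] kl by simp
    next
      case 2
      then show ?thesis using h[OF kl(1)] h[OF kl(2)] mono[of k "real l - 1"] kl by simp
    next
      case 3
      then show ?thesis using h[OF kl(1)] h[OF kl(2)] mono[of "real k + 1" l] kl by simp
    next
      case 4
      then have "k + 1 \<noteq> l" by auto
      then show ?thesis
        using 4 h[OF kl(1)] h[OF kl(2)] mono[of "real k + 1" "real l - 1"] kl by simp
    qed
  qed
  then have "inj_on h {2..<n}"
    by (metis (no_types, lifting) inj_onI linorder_less_linear order_less_irrefl)
  then show ?thesis using h by blast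
qed

section \<open>The sorted list of eigenvalues\<close>

text \<open>
  With \<open>n\<close> distinct eigenvalues known, no multiplicities have to be computed: the characteristic
  polynomial and the product of the linear factors are monic of degree \<open>n\<close> and agree at \<open>n\<close> points.
  Uniqueness of the list follows by comparing the multisets of roots.
\<close>

lemma lap_eigenvalues_eqI:
  assumes xs: "sorted xs" "distinct xs" "length xs = n"
    and ev: "\<And>x. x \<in> set xs \<Longrightarrow> \<exists>v. eigenvector (lap \<alpha> n) v (complex_of_real x)"
  shows "lap_eigenvalues \<alpha> n = xs"
proof -
  let ?P = "\<lambda>xs. \<Prod>x\<leftarrow>xs. [:- complex_of_real x, 1:]"
  have carrier: "lap \<alpha> n \<in> carrier_mat n n" by (simp add: lap_def)
  have proots: "proots (?P ys) = image_mset complex_of_real (mset ys)" for ys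
  proof (induction ys)
    case (Cons y ys)
    have "?P ys \<noteq> 0" by (auto simp: prod_list_zero_iff)
    then show ?case using Cons by (simp add: proots_mult del: mult_pCons_left)
  qed simp
  have "char_poly (lap \<alpha> n) = ?P xs"
  proof (rule poly_eqI_degree_lead_coeff[where A = "complex_of_real ` set xs" and n = n])
    have deg: "degree (?P xs) = n" using xs by (simp add: degree_linear_factors)
    have "card (complex_of_real ` set xs) = n"
      using xs by (simp add: card_image inj_on_def distinct_card)
    then show "n \<le> card (complex_of_real ` set xs)" by simp
    show "degree (char_poly (lap \<alpha> n)) \<le> n" "degree (?P xs) \<le> n"
      using degree_monic_char_poly[OF carrier] deg by simp_all
    have "lead_coeff (?P xs) = 1"
      by (rule monic_prod_list) auto
    then show "coeff (char_poly (lap \<alpha> n)) n = coeff (?P xs) n"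
      using degree_monic_char_poly[OF carrier] deg by simp
  next
    fix z assume "z \<in> complex_of_real ` set xs"
    then obtain x where x: "x \<in> set xs" "z = complex_of_real x" by auto
    have "poly (char_poly (lap \<alpha> n)) z = 0"
      using ev[OF x(1)] eigenvalue_root_char_poly[OF carrier] x(2) by (auto simp: eigenvalue_def)
    moreover have "poly (?P xs) z = 0"
      using x by (auto simp: poly_prod_list prod_list_zero_iff)
    ultimately show "poly (char_poly (lap \<alpha> n)) z = poly (?P xs) z" by simp
  qed
  then show ?thesis
    unfolding lap_eigenvalues_def
  proof (intro the_equality conjI xs(1))
    fix ys assume ys: "sorted ys \<and> char_poly (lap \<alpha> n) = ?P ys"
    then have "image_mset complex_of_real (mset ys) = image_mset complex_of_real (mset xs)"
      using \<open>char_poly (lap \<alpha> n) = ?P xs\<close> proots by metis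
    then have "mset ys = mset xs"
      using multiset.inj_map[of complex_of_real] by (simp add: inj_def)
    then show "ys = xs" using ys xs(1) by (metis properties_for_sort)
  qed
qed

theorem theorem2p5:
  fixes \<alpha> :: complex and n :: nat
  assumes "Re \<alpha> < 0"
    and "int n \<ge> N_min (Re \<alpha>)"
  shows "lap_lambda \<alpha> n 2 = 0
      \<and> eigenvector (lap \<alpha> n) (lap_vec n (\<lambda>k. 1)) (complex_of_real (lap_lambda \<alpha> n 2))
    \<and> (\<forall>j. 3 \<le> j \<and> j \<le> n \<longrightarrow>
        eigenvector (lap \<alpha> n) (lap_vec n (v_trig \<alpha> n j)) (complex_of_real (lap_lambda \<alpha> n j)))
    \<and> eigenvector (lap \<alpha> n) (lap_vec n (v_hyp \<alpha> n)) (complex_of_real (lap_lambda \<alpha> n 1))"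
proof -
  define a where "a = Re \<alpha>"
  have n: "n \<ge> 3" and "int n \<ge> \<lfloor>kappa a\<rfloor> + 1"
    using assms(2) by (simp_all add: N_min_def a_def)
  then have n_kappa: "real n > kappa a" by linarith
  have a: "a < 0" and \<alpha>: "\<alpha> \<noteq> 0" "\<alpha> \<noteq> 1" using assms(1) by (auto simp: a_def)
  have half: "4 * (sin (z / 2))\<^sup>2 = 2 - 2 * cos z" for z :: real
    using cos_double_sin[of "z / 2"] by simp

  obtain s where s: "s > 0" "sinh ((real n + 1) * s / 2) = (1 - 2 * a) * sinh ((real n - 1) * s / 2)"
    using ex_hyperbolic_root[OF a n_kappa n] by blast
  define neg where "neg = - 4 * (sinh (s / 2))\<^sup>2"
  define hyp where "hyp k = complex_of_real (sinh (real k * s))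
     - (1 - cnj \<alpha>) * complex_of_real (sinh ((real k - 1) * s))
     + cnj \<alpha> * complex_of_real (sinh ((real n - real k) * s))" for k
  have sin_i: "sin (of_real x * (\<i> * of_real s)) = \<i> * of_real (sinh (x * s))" for x
  proof -
    have "sin (of_real x * (\<i> * of_real s)) = \<i> * sinh (complex_of_real (x * s))"
      by (simp add: sinh_conv_sin mult_ac)
    also have "sinh (complex_of_real (x * s)) = of_real (sinh (x * s))"
      by (simp add: sinh_field_def exp_minus flip: exp_of_real)
    finally show ?thesis .
  qed
  have neg_ev: "eigenvector (lap \<alpha> n) (lap_vec n hyp) (complex_of_real neg)"
  proof -
    define w where "w = \<i> * complex_of_real s"
    have "sin w = \<i> * of_real (sinh s)" using sin_i[of 1] by (simp add: w_def)
    then have w: "sin w \<noteq> 0" using s(1) by simp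
    have "antisym_factor a n w = 0"
    proof -
      have "antisym_factor a n w = sin (of_real ((real n + 1) / 2) * (\<i> * of_real s))
          - of_real (1 - 2 * a) * sin (of_real ((real n - 1) / 2) * (\<i> * of_real s))"
        by (simp add: antisym_factor_def w_def)
      also have "\<dots> = \<i> * of_real (sinh ((real n + 1) * s / 2) - (1 - 2 * a) * sinh ((real n - 1) * s / 2))"
        unfolding sin_i by (simp add: algebra_simps)
      finally show ?thesis using s(2) by simp
    qed
    moreover have "2 - 2 * cos w = complex_of_real neg"
    proof -
      have "cos w = of_real (cosh s)"
        using cosh_conv_cos[of "of_real s"] by (simp add: w_def cosh_field_def exp_minus flip: exp_of_real)
      moreover have "2 - 2 * cosh s = neg"
        using cosh_double[of "s / 2"] cosh_square_eq[of "s / 2"] by (simp add: neg_def)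
      ultimately show ?thesis by (metis of_real_diff of_real_mult of_real_numeral)
    qed
    moreover have "(\<lambda>k. - \<i> * sine_vec \<alpha> n w (of_nat k)) = hyp"
    proof
      fix k
      have "sine_vec \<alpha> n w (of_nat k) = sin (of_real (real k) * (\<i> * of_real s))
          - (1 - cnj \<alpha>) * sin (of_real (real k - 1) * (\<i> * of_real s))
          + cnj \<alpha> * sin (of_real (real n - real k) * (\<i> * of_real s))"
        by (simp add: sine_vec_def w_def)
      also have "\<dots> = \<i> * hyp k"
        unfolding sin_i hyp_def by (simp add: algebra_simps)
      finally show "- \<i> * sine_vec \<alpha> n w (of_nat k) = hyp k" by simp
    qed
    ultimately show ?thesis
      using eigenvector_if_char_root[OF n \<alpha> w, of "- \<i>"] by (simp add: a_def)
  qed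

  obtain h where h_inj: "inj_on h {2..<n}"
    and h: "\<And>k. k \<in> {2..<n} \<Longrightarrow> 0 < h k" "\<And>k. k \<in> {2..<n} \<Longrightarrow> h k < pi"
      "\<And>k. k \<in> {2..<n} \<Longrightarrow> sin (real n * h k / 2) * antisym_factor a n (h k) = 0"
    using ex_trig_roots[OF a, of n] by blast
  define trig where "trig z k = complex_of_real (sin (real k * z))
     - (1 - cnj \<alpha>) * complex_of_real (sin ((real k - 1) * z))
     + cnj \<alpha> * complex_of_real (sin ((real n - real k) * z))" for z k
  have trig_ev: "eigenvector (lap \<alpha> n) (lap_vec n (trig z)) (complex_of_real (2 - 2 * cos z))"
    if z: "0 < z" "z < pi" "sin (real n * z / 2) * antisym_factor a n z = 0" for z
  proof -
    have w: "sin (complex_of_real z) \<noteq> 0"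
      using sin_gt_zero[OF z(1,2)] by (simp add: sin_of_real)
    have "antisym_factor a n (complex_of_real z) = of_real (antisym_factor a n z)"
      by (simp add: antisym_factor_def flip: sin_of_real)
    moreover have "sin (of_nat n * complex_of_real z / 2) = of_real (sin (real n * z / 2))"
      by (simp flip: sin_of_real)
    ultimately have "sin (of_nat n * complex_of_real z / 2) * antisym_factor a n (complex_of_real z) = 0"
      using z(3) by (metis of_real_0 of_real_mult)
    moreover have "(\<lambda>k. 1 * sine_vec \<alpha> n (of_real z) (of_nat k)) = trig z"
      by (simp add: fun_eq_iff sine_vec_def trig_def flip: sin_of_real)
    ultimately show ?thesis
      using eigenvector_if_char_root[OF n \<alpha> w, of 1] by (simp add: a_def cos_of_real)
  qed
  define pos where "pos = sorted_list_of_set ((\<lambda>k. 2 - 2 * cos (h k)) ` {2..<n})"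
  have pos_set: "set pos = (\<lambda>k. 2 - 2 * cos (h k)) ` {2..<n}" by (simp add: pos_def)
  have pos_gt: "x > 0" if "x \<in> set pos" for x
  proof -
    obtain k where k: "k \<in> {2..<n}" "x = 2 - 2 * cos (h k)"
      using \<open>x \<in> set pos\<close> unfolding pos_set by blast
    then show ?thesis using cos_monotone_0_pi[of 0 "h k"] h(1,2)[OF k(1)] by simp
  qed
  have "inj_on (\<lambda>k. 2 - 2 * cos (h k)) {2..<n}"
  proof (rule inj_onI)
    fix k l assume kl: "k \<in> {2..<n}" "l \<in> {2..<n}" "2 - 2 * cos (h k) = 2 - 2 * cos (h l)"
    have "h k = h l"
      using h(1,2)[OF kl(1)] h(1,2)[OF kl(2)] kl(3) by - (rule cos_inj_pi, simp_all)
    then show "k = l" using h_inj kl(1,2) by (auto dest: inj_onD)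
  qed
  then have pos_len: "length pos = n - 2" by (simp add: pos_def card_image)
  have neg_lt: "neg < 0" using s(1) by (simp add: neg_def)
  have list: "lap_eigenvalues \<alpha> n = neg # 0 # pos"
  proof (rule lap_eigenvalues_eqI)
    show "sorted (neg # 0 # pos)" using neg_lt pos_gt by (auto simp: pos_def intro: less_imp_le order.strict_trans)
    show "distinct (neg # 0 # pos)" using neg_lt pos_gt by (force simp: pos_def)
    show "length (neg # 0 # pos) = n" using pos_len n by simp
    show "\<exists>v. eigenvector (lap \<alpha> n) v (complex_of_real x)" if x: "x \<in> set (neg # 0 # pos)" for x
    proof -
      consider "x = neg" | "x = 0" | k where "k \<in> {2..<n}" "x = 2 - 2 * cos (h k)"
        using x unfolding list.set pos_set by blast
      then show ?thesis
      proof cases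
        case 1
        then show ?thesis using neg_ev by blast
      next
        case 2
        then show ?thesis using eigenvector_ones[OF n, of \<alpha>] by auto
      next
        case 3
        then show ?thesis using trig_ev[OF h[OF 3(1)]] by blast
      qed
    qed
  qed
  have lam1: "lap_lambda \<alpha> n 1 = neg" and lam2: "lap_lambda \<alpha> n 2 = 0"
    by (simp_all add: lap_lambda_def list)
  have "lap_s \<alpha> n = s"
    unfolding lap_s_def lam1 neg_def
  proof (rule the_equality)
    fix t assume t: "0 < t \<and> - 4 * (sinh (t / 2))\<^sup>2 = - 4 * (sinh (s / 2))\<^sup>2"
    then have "sinh (t / 2) = sinh (s / 2)"
      using s(1) by (auto simp: power2_eq_iff_nonneg)
    then show "t = s" by simp
  qed (use s in simp)
  then have "v_hyp \<alpha> n = hyp" by (simp add: fun_eq_iff v_hyp_def hyp_def)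
  moreover have "eigenvector (lap \<alpha> n) (lap_vec n (v_trig \<alpha> n j)) (complex_of_real (lap_lambda \<alpha> n j))"
    if j: "3 \<le> j" "j \<le> n" for j
  proof -
    have "lap_lambda \<alpha> n j = pos ! (j - 3)"
      using j by (simp add: lap_lambda_def list nth_Cons' eval_nat_numeral)
    moreover have "pos ! (j - 3) \<in> set pos" using j pos_len by simp
    ultimately obtain k where k: "k \<in> {2..<n}" "lap_lambda \<alpha> n j = 2 - 2 * cos (h k)"
      unfolding pos_set by auto
    have "lap_z \<alpha> n j = h k"
      unfolding lap_z_def k(2) half
    proof (rule the_equality)
      show "0 \<le> h k \<and> h k \<le> pi \<and> 2 - 2 * cos (h k) = 2 - 2 * cos (h k)"
        using h(1,2)[OF k(1)] by simp
      show "z = h k" if "0 \<le> z \<and> z \<le> pi \<and> 2 - 2 * cos z = 2 - 2 * cos (h k)" for z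
        using that h(1,2)[OF k(1)] by - (rule cos_inj_pi, simp_all)
    qed
    then have "v_trig \<alpha> n j = trig (h k)" by (simp add: fun_eq_iff v_trig_def trig_def)
    then show ?thesis using trig_ev[OF h[OF k(1)]] k(2) by simp
  qed
  ultimately show ?thesis
    using neg_ev lam1 lam2 eigenvector_ones[OF n, of \<alpha>] by simp
qed

end
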